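(* In the noisy HRIS observation model described in the context, for every fixed HRIS reception configuration $\boldsymbol\Phi=\{\boldsymbol\rho(b),\boldsymbol\phi(b)\}_{b=1}^B$ the users-HRIS channel $\mathbf{G}$ can be recovered from the HRIS observation $\mathbf{y}_{\rm RC}$ with mean-squared error $$\mathcal{E}_{\mathbf{G}}(\boldsymbol\Phi)=\mathrm{Tr}\left\{\left(\mathbf{R}_{\rm G}^{-1}+T\frac{\Gamma}{K}\,\mathbf{A}_{\rm RC}(\boldsymbol\Phi)^H\mathbf{A}_{\rm RC}(\boldsymbol\Phi)\right)^{-1}\right\},\qquad \mathbf{R}_{\rm G}=\Big(\sum_{k=1}^K\gamma_k\Big)\mathbf{I}_N,$$ i.e., there is an estimator $\hat{\mathbf{G}}$ computed from $\mathbf{y}_{\rm RC}$ with $\mathbb{E}\{\|\mathbf{G}-\hat{\mathbf{G}}\|_F^2\}=\mathcal{E}_{\mathbf{G}}(\boldsymbol\Phi)$.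
   Context: $N,K,N_r,B,T$ are positive integers. $\mathbf{G}=[\mathbf{g}_1,\dots,\mathbf{g}_K]\in\mathbb{C}^{N\times K}$ is random with independent zero-mean circularly-symmetric complex Gaussian entries, those of $\mathbf{g}_k$ having variance $\gamma_k>0$ (known). The HRIS (hybrid reconfigurable intelligent surface) has $N$ elements and $N_r$ receive RF chains. For each sub-frame $b=1,\dots,B$ its reception configuration consists of $\rho_l(b)\in[0,1]$ and $\phi_{r,l}(b)\in[0,2\pi)$, and defines $\boldsymbol\Phi(\boldsymbol\rho(b),\boldsymbol\phi(b))\in\mathbb{C}^{N_r\times N}$ with $(r,l)$ entry $(1-\rho_l(b))e^{\jmath\phi_{r,l}(b)}$ if element $l$ is connected to RF chain $r$, and $0$ otherwise (the connection pattern is fixed). Set $$\mathbf{A}_{\rm RC}(\boldsymbol\Phi)=\big[\boldsymbol\Phi(\boldsymbol\rho(1),\boldsymbol\phi(1))^T,\dots,\boldsymbol\Phi(\boldsymbol\rho(B),\boldsymbol\phi(B))^T\big]^T\in\mathbb{C}^{N_rB\times N}.$$ The known pilot matrix $\mathbf{S}\in\mathbb{C}^{K\times T}$ satisfies $\mathbf{S}\mathbf{S}^H=T\mathbf{I}_K$. The HRIS observes $$\mathbf{y}_{\rm RC}=\mathbf{A}_{\rm RC}(\boldsymbol\Phi)\,\mathbf{G}\,\mathbf{S}+\mathbf{z}_{\rm RC}\in\mathbb{C}^{N_rB\times T},$$ where $\mathbf{z}_{\rm RC}$ is independent of $\mathbf{G}$ and has i.i.d. zero-mean circularly-symmetric complex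 Gaussian entries of variance $1/\Gamma$. Here $\Gamma=P_t/\sigma^2>0$ is the transmit SNR ($P_t$ is each user's pilot transmit power, $\sigma^2$ the noise variance), the received signal having been normalized by $\sqrt{P_t}$. *)

theory Defs
  imports "HOL-Probability.Probability"
begin

definition hermitian_transpose :: "complex ^ 'n ^ 'm \<Rightarrow> complex ^ 'm ^ 'n"
  where "hermitian_transpose A = (\<chi> i j. cnj (A $ j $ i))"

text \<open>
  The law CN(0, v): independent real and imaginary parts, each centred Gaussian of variance
  v / 2 (\<^const>\<open>normal_density\<close> takes the standard deviation).
\<close>
definition circ_gaussian :: "'w measure \<Rightarrow> ('w \<Rightarrow> complex) \<Rightarrow> real \<Rightarrow> bool"
  where "circ_gaussian M X v \<longleftrightarrow>
    prob_space.indep_var M borel (\<lambda>\<omega>. Re (X \<omega>)) borel (\<lambda>\<omega>. Im (X \<omega>)) \<and>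
    distributed M lborel (\<lambda>\<omega>. Re (X \<omega>)) (normal_density 0 (sqrt (v / 2))) \<and>
    distributed M lborel (\<lambda>\<omega>. Im (X \<omega>)) (normal_density 0 (sqrt (v / 2)))"

definition indep_circ_gaussian_entries ::
    "'w measure \<Rightarrow> ('w \<Rightarrow> complex ^ 'n ^ 'm) \<Rightarrow> ('m \<Rightarrow> 'n \<Rightarrow> real) \<Rightarrow> bool"
  where "indep_circ_gaussian_entries M X v \<longleftrightarrow>
    prob_space.indep_vars M (\<lambda>_. borel) (\<lambda>(i, j) \<omega>. X \<omega> $ i $ j) UNIV \<and>
    (\<forall>i j. circ_gaussian M (\<lambda>\<omega>. X \<omega> $ i $ j) (v i j))"

text \<open>
  The library's \<^const>\<open>prob_space.indep_var\<close> requires both random variables to have the same type,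
  which matrices of different sizes do not; this is independence of the generated sigma-algebras.
\<close>
definition indep_random_variables ::
    "'w measure \<Rightarrow> ('w \<Rightarrow> 'x::topological_space) \<Rightarrow> ('w \<Rightarrow> 'y::topological_space) \<Rightarrow> bool"
  where "indep_random_variables M X Y \<longleftrightarrow>
    X \<in> borel_measurable M \<and> Y \<in> borel_measurable M \<and>
    prob_space.indep_set M (sets (vimage_algebra (space M) X borel))
      (sets (vimage_algebra (space M) Y borel))"

text \<open>
  Index types: \<^typ>\<open>'n\<close> for the HRIS elements, \<^typ>\<open>'r\<close> for the receive RF chains, \<^typ>\<open>'b\<close> for the
  sub-frames, \<^typ>\<open>'k\<close> for the users, \<^typ>\<open>'t\<close> for the pilot symbols. The relation
  \<open>conn r l\<close> says that element \<open>l\<close> is connected to RF chain \<open>r\<close>.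
\<close>
definition reception_config ::
    "('b \<Rightarrow> 'n \<Rightarrow> real) \<Rightarrow> ('b \<Rightarrow> 'r \<Rightarrow> 'n \<Rightarrow> real) \<Rightarrow> bool"
  where "reception_config \<rho> \<phi> \<longleftrightarrow>
    (\<forall>b l. \<rho> b l \<in> {0..1}) \<and> (\<forall>b r l. \<phi> b r l \<in> {0..<2 * pi})"

definition Phi_mat ::
    "('r::finite \<Rightarrow> 'n::finite \<Rightarrow> bool) \<Rightarrow> ('n \<Rightarrow> real) \<Rightarrow> ('r \<Rightarrow> 'n \<Rightarrow> real) \<Rightarrow> complex ^ 'n ^ 'r"
  where "Phi_mat conn \<rho> \<phi> =
    (\<chi> r l. if conn r l then complex_of_real (1 - \<rho> l) * exp (\<i> * complex_of_real (\<phi> r l)) else 0)"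

text \<open>Vertical stacking of the B blocks: row \<open>(b, r)\<close> is row \<open>r\<close> of block \<open>b\<close>.\<close>
definition A_RC ::
    "('r::finite \<Rightarrow> 'n::finite \<Rightarrow> bool) \<Rightarrow> ('b::finite \<Rightarrow> 'n \<Rightarrow> real) \<Rightarrow> ('b \<Rightarrow> 'r \<Rightarrow> 'n \<Rightarrow> real)
      \<Rightarrow> complex ^ 'n ^ ('b \<times> 'r)"
  where "A_RC conn \<rho> \<phi> = (\<chi> p. Phi_mat conn (\<rho> (fst p)) (\<phi> (fst p)) $ snd p)"

definition R_G :: "('k::finite \<Rightarrow> real) \<Rightarrow> complex ^ 'n ^ 'n"
  where "R_G \<gamma> = (\<Sum>k\<in>UNIV. \<gamma> k) *\<^sub>R mat 1"

definition y_RC ::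
    "complex ^ 'n ^ 'm \<Rightarrow> complex ^ 't ^ 'k \<Rightarrow> complex ^ 'k ^ 'n \<Rightarrow> complex ^ 't ^ 'm
      \<Rightarrow> complex ^ 't ^ 'm"
  where "y_RC A S G Z = A ** G ** S + Z"

definition channel_mse ::
    "('k::finite \<Rightarrow> real) \<Rightarrow> nat \<Rightarrow> real \<Rightarrow> complex ^ 'n ^ 'm \<Rightarrow> complex"
  where "channel_mse \<gamma> T \<Gamma> A =
    trace (matrix_inv (matrix_inv (R_G \<gamma>) +
      (real T * (\<Gamma> / real CARD('k))) *\<^sub>R (hermitian_transpose A ** A)))"

text \<open>
  On matrices over \<^typ>\<open>complex\<close>, the library's \<^const>\<open>norm\<close> is the Euclidean norm of the row
  norms, that is, the Frobenius norm.
\<close>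
definition mean_squared_error ::
    "'w measure \<Rightarrow> ('w \<Rightarrow> complex ^ 'k ^ 'n) \<Rightarrow> ('w \<Rightarrow> complex ^ 'k ^ 'n) \<Rightarrow> real"
  where "mean_squared_error M X Xhat = (\<integral>\<omega>. (norm (X \<omega> - Xhat \<omega>))\<^sup>2 \<partial>M)"

end

theory Submission
  imports Defs
begin

text \<open>
  Since S is orthogonal up to the factor T, applying \<open>S\<^sup>H / T\<close> to the observation decouples the
  users. A single linear filter is then applied to every user's column, namely the minimum mean-square
  error filter for the total variance \<open>g = \<gamma>\<^sub>1 + \<dots> + \<gamma>\<^sub>K\<close> (not the optimal one for each \<open>\<gamma>\<^sub>k\<close>).
  With \<open>c = T \<Gamma> / K\<close> and \<open>C = (I / g + c A\<^sup>H A)\<^sup>-\<^sup>1\<close> it is \<open>c C A\<^sup>H\<close>, so that \<open>I - c C A\<^sup>H A = C / g\<close>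
  and the error is \<open>C G / g - (c / T) C A\<^sup>H Z S\<^sup>H\<close>. All entries of G and Z are
  orthogonal in \<open>L\<^sup>2\<close>, hence its mean square is
  \<open>\<parallel>C\<parallel>\<^sup>2 / g + c \<parallel>C A\<^sup>H\<parallel>\<^sup>2 = tr (C (I / g + c A\<^sup>H A) C) = tr C\<close>.
\<close>

lemma borel_measurable_cnj [measurable]: "cnj \<in> borel_measurable borel"
  by (intro borel_measurable_continuous_onI continuous_intros)

section \<open>Frobenius norm, trace and conjugate transpose\<close>

lemma norm_matrix_squared:
  fixes A :: "complex ^ 'n::finite ^ 'm::finite"
  shows "(norm A)\<^sup>2 = (\<Sum>i\<in>UNIV. \<Sum>j\<in>UNIV. (cmod (A $ i $ j))\<^sup>2)"
  by (simp add: norm_vec_def L2_set_def sum_nonneg)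

lemma trace_mult_hermitian_transpose:
  fixes A :: "complex ^ 'n::finite ^ 'm::finite"
  shows "trace (A ** hermitian_transpose A) = complex_of_real ((norm A)\<^sup>2)"
  unfolding norm_matrix_squared trace_def matrix_matrix_mult_def hermitian_transpose_def
  by (simp add: complex_norm_square del: of_real_power)

lemma matrix_add_rdistrib:
  fixes A B :: "'a::semiring_1 ^ 'n::finite ^ 'm"
  shows "(A + B) ** C = A ** C + B ** C"
  by (simp add: matrix_matrix_mult_def vec_eq_iff distrib_right sum.distrib)

lemma trace_scaleR: "trace (r *\<^sub>R A) = r *\<^sub>R trace (A :: complex ^ 'n::finite ^ 'n)"
  by (simp add: trace_def scaleR_sum_right)

lemma hermitian_transpose_mult:
  "hermitian_transpose (A ** B) = hermitian_transpose B ** hermitian_transpose A"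
  by (simp add: hermitian_transpose_def matrix_matrix_mult_def vec_eq_iff mult.commute)

lemma hermitian_transpose_add:
  "hermitian_transpose (A + B) = hermitian_transpose A + hermitian_transpose B"
  by (simp add: hermitian_transpose_def vec_eq_iff)

lemma hermitian_transpose_scaleR:
  "hermitian_transpose (r *\<^sub>R A) = r *\<^sub>R hermitian_transpose A"
  by (simp add: hermitian_transpose_def vec_eq_iff)

lemma hermitian_transpose_mat_1: "hermitian_transpose (mat 1) = mat 1"
  by (simp add: hermitian_transpose_def mat_def vec_eq_iff)

lemma hermitian_transpose_hermitian_transpose [simp]:
  "hermitian_transpose (hermitian_transpose A) = A"
  by (simp add: hermitian_transpose_def vec_eq_iff)

lemma norm_hermitian_transpose:
  fixes A :: "complex ^ 'n::finite ^ 'm::finite"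
  shows "norm (hermitian_transpose A) = norm A"
proof -
  have "(norm (hermitian_transpose A))\<^sup>2 = (norm A)\<^sup>2"
    unfolding norm_matrix_squared
    by (subst sum.swap) (simp add: hermitian_transpose_def)
  then show ?thesis
    by simp
qed

section \<open>Matrix inverses and regularized Gram matrices\<close>

lemma matrix_inv_unique:
  fixes A B :: "complex ^ 'n::finite ^ 'n"
  assumes "A ** B = mat 1"
  shows "matrix_inv A = B"
proof -
  \<comment> \<open>For square matrices a right inverse is also a left inverse. Hence the choice
    operator in \<open>matrix_inv\<close> has a witness and really yields an inverse.\<close>
  have "B ** A = mat 1"
    using assms matrix_left_right_inverse by blast
  then have "\<exists>C. A ** C = mat 1 \<and> C ** A = mat 1"
    using assms by blast
  then have "matrix_inv A ** A = mat 1"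
    unfolding matrix_inv_def by (rule someI2_ex) simp
  then have "matrix_inv A = matrix_inv A ** (A ** B)"
    using assms by simp
  also have "\<dots> = B"
    using \<open>matrix_inv A ** A = mat 1\<close> by (simp add: matrix_mul_assoc)
  finally show ?thesis .
qed

lemma matrix_inv_scaleR_mat_1:
  assumes "r \<noteq> 0"
  shows "matrix_inv (r *\<^sub>R mat 1 :: complex ^ 'n::finite ^ 'n) = (1 / r) *\<^sub>R mat 1"
  using assms by (intro matrix_inv_unique) (simp add: matrix_scalar_ac flip: scalar_matrix_assoc)

text \<open>Moving \<open>A\<close> to the other side of the inner product shows that the Gram
  matrix is positive semidefinite, which is what makes its regularization injective.\<close>

lemma gram_quadratic_form:
  fixes A :: "complex ^ 'n::finite ^ 'm::finite"
  shows "(\<Sum>i\<in>UNIV. cnj (x $ i) * ((hermitian_transpose A ** A) *v x) $ i)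
    = complex_of_real ((norm (A *v x))\<^sup>2)"
proof -
  have adj: "(hermitian_transpose A *v y) $ i = (\<Sum>j\<in>UNIV. cnj (A $ j $ i) * y $ j)" for y i
    by (simp add: hermitian_transpose_def matrix_vector_mult_def)
  have "(\<Sum>i\<in>UNIV. cnj (x $ i) * ((hermitian_transpose A ** A) *v x) $ i)
      = (\<Sum>i\<in>UNIV. \<Sum>j\<in>UNIV. cnj (A $ j $ i * x $ i) * (A *v x) $ j)"
    by (simp add: adj sum_distrib_left mult_ac flip: matrix_vector_mul_assoc)
  also have "\<dots> = (\<Sum>j\<in>UNIV. cnj ((A *v x) $ j) * (A *v x) $ j)"
    by (subst sum.swap) (simp add: matrix_vector_mult_def sum_distrib_right)
  also have "\<dots> = complex_of_real ((norm (A *v x))\<^sup>2)"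
    by (simp add: norm_vec_def L2_set_def sum_nonneg complex_norm_square mult.commute
      del: of_real_power)
  finally show ?thesis .
qed

text \<open>A square matrix with trivial kernel is invertible. Pairing a kernel vector
  \<open>x\<close> with itself gives a |x|^2 + c |A x|^2 = 0; both terms are nonnegative and a > 0,
  so x = 0.\<close>

lemma regularized_gram_invertible:
  fixes A :: "complex ^ 'n::finite ^ 'm::finite"
  assumes "a > 0" "c \<ge> 0"
  shows "invertible (a *\<^sub>R mat 1 + c *\<^sub>R (hermitian_transpose A ** A))"
proof -
  let ?H = "hermitian_transpose A ** A"
  have "x = 0" if x: "(a *\<^sub>R mat 1 + c *\<^sub>R ?H) *v x = 0" for x
  proof -
    have "(r *\<^sub>R D) *v x = r *\<^sub>R (D *v x)" for r and D :: "complex ^ 'n ^ 'n"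
      by (simp add: matrix_vector_mult_def vec_eq_iff scaleR_sum_right)
    then have "((a *\<^sub>R mat 1 + c *\<^sub>R ?H) *v x) $ i
        = of_real a * x $ i + of_real c * (?H *v x) $ i" for i
      by (simp add: matrix_vector_mult_add_rdistrib scaleR_conv_of_real [where 'a = complex])
    then have "0 = (\<Sum>i\<in>UNIV. cnj (x $ i) * (of_real a * x $ i + of_real c * (?H *v x) $ i))"
      using x by (metis (no_types, lifting) mult_zero_right sum.neutral zero_index)
    also have "\<dots> = of_real a * (\<Sum>i\<in>UNIV. cnj (x $ i) * x $ i)
        + of_real c * (\<Sum>i\<in>UNIV. cnj (x $ i) * (?H *v x) $ i)"
      by (simp add: sum.distrib sum_distrib_left algebra_simps)
    also have "(\<Sum>i\<in>UNIV. cnj (x $ i) * x $ i) = complex_of_real ((norm x)\<^sup>2)"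
      by (simp add: norm_vec_def L2_set_def sum_nonneg complex_norm_square mult.commute
      del: of_real_power)
    finally have "complex_of_real (a * (norm x)\<^sup>2 + c * (norm (A *v x))\<^sup>2) = 0"
      by (simp add: gram_quadratic_form)
    then have "a * (norm x)\<^sup>2 + c * (norm (A *v x))\<^sup>2 = 0"
      by (simp only: of_real_eq_0_iff)
    moreover have "c * (norm (A *v x))\<^sup>2 \<ge> 0" "a * (norm x)\<^sup>2 \<ge> 0"
      using assms by simp_all
    ultimately have "a * (norm x)\<^sup>2 = 0"
      by linarith
    then show "x = 0"
      using assms by simp
  qed
  then show ?thesis
    by (simp add: invertible_left_inverse matrix_left_invertible_ker)
qed

section \<open>Orthogonality in L^2\<close>

lemma square_integrable_mult_cnj:
  fixes X Y :: "'w \<Rightarrow> complex"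
  assumes [measurable]: "X \<in> borel_measurable M" "Y \<in> borel_measurable M"
    and "integrable M (\<lambda>\<omega>. (cmod (X \<omega>))\<^sup>2)" "integrable M (\<lambda>\<omega>. (cmod (Y \<omega>))\<^sup>2)"
  shows "integrable M (\<lambda>\<omega>. X \<omega> * cnj (Y \<omega>))"
proof (rule Bochner_Integration.integrable_bound)
  show "(\<lambda>\<omega>. X \<omega> * cnj (Y \<omega>)) \<in> borel_measurable M"
    by measurable
  show "integrable M (\<lambda>\<omega>. (cmod (X \<omega>))\<^sup>2 + (cmod (Y \<omega>))\<^sup>2)"
    using assms by simp
  show "AE \<omega> in M. norm (X \<omega> * cnj (Y \<omega>)) \<le> norm ((cmod (X \<omega>))\<^sup>2 + (cmod (Y \<omega>))\<^sup>2)"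
  proof (rule AE_I2)
    fix \<omega>
    \<comment> \<open>Expanding the square gives 2 |X| |Y| \<le> 2 (|X|^2 + |Y|^2), which is the
      required domination.\<close>
    have "0 \<le> (cmod (X \<omega>) - cmod (Y \<omega>))\<^sup>2 + ((cmod (X \<omega>))\<^sup>2 + (cmod (Y \<omega>))\<^sup>2)"
      by simp
    then show "norm (X \<omega> * cnj (Y \<omega>)) \<le> norm ((cmod (X \<omega>))\<^sup>2 + (cmod (Y \<omega>))\<^sup>2)"
      by (simp add: norm_mult power2_diff)
  qed
qed

text \<open>Pythagoras in L^2: the squared modulus expands into a double sum whose off-diagonal
  terms integrate to 0. Stating it with \<open>has_bochner_integral\<close> delivers integrability
  and value together.\<close>

lemma orthogonal_linear_combination:
  fixes X :: "'i \<Rightarrow> 'w \<Rightarrow> complex" and c :: "'i \<Rightarrow> complex"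
  assumes "finite I"
    and X: "\<And>i. i \<in> I \<Longrightarrow> X i \<in> borel_measurable M"
    and sq: "\<And>i. i \<in> I \<Longrightarrow> has_bochner_integral M (\<lambda>\<omega>. (cmod (X i \<omega>))\<^sup>2) (v i)"
    and orth: "\<And>i j. i \<in> I \<Longrightarrow> j \<in> I \<Longrightarrow> i \<noteq> j \<Longrightarrow> (\<integral>\<omega>. X i \<omega> * cnj (X j \<omega>) \<partial>M) = 0"
  shows "has_bochner_integral M (\<lambda>\<omega>. (cmod (\<Sum>i\<in>I. c i * X i \<omega>))\<^sup>2)
    (\<Sum>i\<in>I. (cmod (c i))\<^sup>2 * v i)"
proof -
  have pair: "has_bochner_integral M (\<lambda>\<omega>. X i \<omega> * cnj (X j \<omega>)) (if i = j then of_real (v i) else 0)"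
    if "i \<in> I" "j \<in> I" for i j
  proof -
    have "integrable M (\<lambda>\<omega>. X i \<omega> * cnj (X j \<omega>))"
      using X sq that by (intro square_integrable_mult_cnj) (auto simp: has_bochner_integral_iff)
    moreover have "(\<integral>\<omega>. X i \<omega> * cnj (X i \<omega>) \<partial>M) = of_real (v i)"
      using sq[OF that(1)]
      by (simp add: has_bochner_integral_iff flip: complex_norm_square of_real_power)
    ultimately show ?thesis
      using orth that by (auto simp: has_bochner_integral_iff)
  qed
  have "has_bochner_integral M
      (\<lambda>\<omega>. \<Sum>i\<in>I. \<Sum>j\<in>I. (c i * cnj (c j)) * (X i \<omega> * cnj (X j \<omega>)))
      (\<Sum>i\<in>I. \<Sum>j\<in>I. (c i * cnj (c j)) * (if i = j then of_real (v i) else 0))"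
    by (intro has_bochner_integral_sum has_bochner_integral_mult_right pair)
  moreover have "(\<Sum>i\<in>I. \<Sum>j\<in>I. (c i * cnj (c j)) * (X i \<omega> * cnj (X j \<omega>)))
      = of_real ((cmod (\<Sum>i\<in>I. c i * X i \<omega>))\<^sup>2)" for \<omega>
    by (simp add: complex_norm_square sum_product mult_ac del: of_real_power)
  moreover have "(\<Sum>i\<in>I. \<Sum>j\<in>I. (c i * cnj (c j)) * (if i = j then of_real (v i) else 0))
      = complex_of_real (\<Sum>i\<in>I. (cmod (c i))\<^sup>2 * v i)"
    using \<open>finite I\<close>
      by (simp add: complex_norm_square if_distrib del: of_real_power cong: if_cong)
  ultimately have "has_bochner_integral M (\<lambda>\<omega>. complex_of_real ((cmod (\<Sum>i\<in>I. c i * X i \<omega>))\<^sup>2))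
      (complex_of_real (\<Sum>i\<in>I. (cmod (c i))\<^sup>2 * v i))"
    by simp
  \<comment> \<open>The expansion lives in the complex numbers because of the conjugates; the real
    part brings the identity back to the reals.\<close>
  from has_bochner_integral_Re[OF this] show ?thesis
    by (simp only: Re_complex_of_real)
qed

section \<open>Independence and Gaussian moments\<close>

lemma sigma_sets_vimage_compose_subset:
  fixes W :: "'w \<Rightarrow> 'x::topological_space"
  assumes "h \<in> borel \<rightarrow>\<^sub>M N"
  shows "sigma_sets \<Omega> {(\<lambda>\<omega>. h (W \<omega>)) -` E \<inter> \<Omega> | E. E \<in> sets N}
    \<subseteq> sets (vimage_algebra \<Omega> W borel)"
proof -
  \<comment> \<open>A function of \<open>W\<close> is measurable for the sigma-algebra generated by
    \<open>W\<close>, so the sigma-algebra it generates is contained in that one.\<close>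
  have "(\<lambda>\<omega>. h (W \<omega>)) \<in> vimage_algebra \<Omega> W borel \<rightarrow>\<^sub>M N"
    by (rule measurable_compose[OF measurable_vimage_algebra1 assms]) simp
  then show ?thesis
    by (intro sets.sigma_sets_subset[of _ "vimage_algebra \<Omega> W borel",
            unfolded space_vimage_algebra])
        (auto dest: measurable_sets)
qed

context prob_space
begin

lemma centred_gaussian_moments:
  assumes D: "distributed M lborel X (normal_density 0 s)" and s: "s > 0"
  shows "has_bochner_integral M X 0" "has_bochner_integral M (\<lambda>\<omega>. (X \<omega>)\<^sup>2) (s\<^sup>2)"
proof -
  have "integrable M X"
    using distributed_integrable[OF D, of "\<lambda>x. x"] integrable_normal_moment[OF s, of 0 1] by simp
  moreover have mean: "expectation X = 0"
    using normal_distributed_expectation[OF s D] .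
  ultimately show "has_bochner_integral M X 0"
    by (simp add: has_bochner_integral_iff)
  have "integrable M (\<lambda>\<omega>. (X \<omega>)\<^sup>2)"
    using distributed_integrable[OF D, of "\<lambda>x. x\<^sup>2"] integrable_normal_moment[OF s, of 0 2] by simp
  \<comment> \<open>The variance is centred at the mean; as the mean is 0, it is the second
    moment.\<close>
  then show "has_bochner_integral M (\<lambda>\<omega>. (X \<omega>)\<^sup>2) (s\<^sup>2)"
    using normal_distributed_variance[OF s D] mean by (simp add: has_bochner_integral_iff)
qed

text \<open>Real and imaginary part each contribute mean 0 and second moment v / 2.\<close>

lemma circ_gaussian_moments:
  assumes "circ_gaussian M X v" "v > 0"
  shows "has_bochner_integral M X 0" "has_bochner_integral M (\<lambda>\<omega>. (cmod (X \<omega>))\<^sup>2) v"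
proof -
  have s: "sqrt (v / 2) > 0"
    using assms by simp
  have Re: "distributed M lborel (\<lambda>\<omega>. Re (X \<omega>)) (normal_density 0 (sqrt (v / 2)))"
    and Im: "distributed M lborel (\<lambda>\<omega>. Im (X \<omega>)) (normal_density 0 (sqrt (v / 2)))"
    using assms by (auto simp: circ_gaussian_def)
  note Re = centred_gaussian_moments[OF Re s] and Im = centred_gaussian_moments[OF Im s]
  have "has_bochner_integral M (\<lambda>\<omega>. of_real (Re (X \<omega>)) + \<i> * of_real (Im (X \<omega>)))
      (of_real 0 + \<i> * of_real 0)"
    by (intro has_bochner_integral_add has_bochner_integral_mult_right
        has_bochner_integral_of_real Re Im)
  then show "has_bochner_integral M X 0"
    by (simp flip: complex_eq)
  show "has_bochner_integral M (\<lambda>\<omega>. (cmod (X \<omega>))\<^sup>2) v"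
    using has_bochner_integral_add[OF Re(2) Im(2)] assms by (simp add: cmod_power2)
qed

text \<open>Passage from independence of the generated sigma-algebras to \<open>indep_var\<close>:
  the maps \<open>f\<close> and \<open>g\<close>, later entry projections, send matrices of
  different sizes into a common type, and shrinking the sigma-algebras preserves
  independence.\<close>

lemma indep_random_variables_compose:
  fixes X :: "'a \<Rightarrow> 'x::topological_space" and Y :: "'a \<Rightarrow> 'y::topological_space"
  assumes "indep_random_variables M X Y" "f \<in> borel \<rightarrow>\<^sub>M S" "g \<in> borel \<rightarrow>\<^sub>M T"
  shows "indep_var S (\<lambda>\<omega>. f (X \<omega>)) T (\<lambda>\<omega>. g (Y \<omega>))"
proof -
  have [measurable]: "X \<in> borel_measurable M" "Y \<in> borel_measurable M"
    using assms by (auto simp: indep_random_variables_def)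
  note [measurable] = assms(2,3)
  have "indep_set (sets (vimage_algebra (space M) X borel)) (sets (vimage_algebra (space M) Y borel))"
    using assms by (simp add: indep_random_variables_def)
  then have "indep_set
      (sigma_sets (space M) {(\<lambda>\<omega>. f (X \<omega>)) -` E \<inter> space M | E. E \<in> sets S})
      (sigma_sets (space M) {(\<lambda>\<omega>. g (Y \<omega>)) -` E \<inter> space M | E. E \<in> sets T})"
    unfolding indep_set_def
    by (rule indep_sets_mono_sets)
      (simp add: sigma_sets_vimage_compose_subset[OF assms(2)]
        sigma_sets_vimage_compose_subset[OF assms(3)] split: bool.split)
  then show ?thesis
    by (simp add: indep_var_eq)
qed

lemma indep_vars_uncorrelated:
  fixes X :: "'i \<Rightarrow> 'a \<Rightarrow> complex"
  assumes "indep_vars (\<lambda>_. borel) X UNIV" "i \<noteq> j"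
    and "has_bochner_integral M (X i) 0" "integrable M (X j)"
  shows "expectation (\<lambda>\<omega>. X i \<omega> * cnj (X j \<omega>)) = 0"
proof -
  \<comment> \<open>Conjugating only component \<open>j\<close> keeps the family independent and
    turns the product over {i, j} into the desired one. Its expectation factorizes, and the factor
    for \<open>i\<close> is 0.\<close>
  let ?Y = "\<lambda>k z. if k = j then cnj z else z"
  have "indep_vars (\<lambda>_. borel) (\<lambda>k \<omega>. ?Y k (X k \<omega>)) {i, j}"
    by (rule indep_vars_compose2[OF indep_vars_subset[OF assms(1)]]) auto
  then have "expectation (\<lambda>\<omega>. \<Prod>k\<in>{i, j}. ?Y k (X k \<omega>)) = (\<Prod>k\<in>{i, j}. expectation (\<lambda>\<omega>. ?Y k (X k \<omega>)))"
    using assms by (intro indep_vars_lebesgue_integral) (auto simp: has_bochner_integral_iff)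
  then show ?thesis
    using assms by (simp add: has_bochner_integral_iff)
qed

text \<open>Every entry is a linear combination of pairwise orthogonal variables, so its mean square
  is a weighted sum of variances. As \<open>P\<close> acts alike on all columns of \<open>G\<close>,
  the \<gamma>'s enter only through their sum.\<close>

lemma mean_squared_norm_linear_combination:
  fixes G :: "'a \<Rightarrow> complex ^ 'k::finite ^ 'n::finite"
    and Z :: "'a \<Rightarrow> complex ^ 't::finite ^ 'm::finite"
    and P :: "complex ^ 'n ^ 'l::finite" and Q :: "complex ^ 'm ^ 'l" and R :: "complex ^ 'k ^ 't"
  assumes G: "indep_circ_gaussian_entries M G (\<lambda>l k. \<gamma> k)"
    and Z: "indep_circ_gaussian_entries M Z (\<lambda>p t. v)"
    and GZ: "indep_random_variables M G Z"
    and pos: "\<And>k. \<gamma> k > 0" "v > 0"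
  shows "has_bochner_integral M (\<lambda>\<omega>. (norm (P ** G \<omega> + Q ** Z \<omega> ** R))\<^sup>2)
    ((norm P)\<^sup>2 * (\<Sum>k\<in>UNIV. \<gamma> k) + (norm Q)\<^sup>2 * (norm R)\<^sup>2 * v)"
proof -
  have Gvars: "indep_vars (\<lambda>_. borel) (\<lambda>(i, j) \<omega>. G \<omega> $ i $ j) UNIV"
    and Zvars: "indep_vars (\<lambda>_. borel) (\<lambda>(i, j) \<omega>. Z \<omega> $ i $ j) UNIV"
    using G Z by (auto simp: indep_circ_gaussian_entries_def)
  have Gmom: "has_bochner_integral M (\<lambda>\<omega>. G \<omega> $ l $ k) 0"
      "has_bochner_integral M (\<lambda>\<omega>. (cmod (G \<omega> $ l $ k))\<^sup>2) (\<gamma> k)" for l k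
    using circ_gaussian_moments[of "\<lambda>\<omega>. G \<omega> $ l $ k" "\<gamma> k"] G pos
    by (auto simp: indep_circ_gaussian_entries_def)
  have Zmom: "has_bochner_integral M (\<lambda>\<omega>. Z \<omega> $ p $ t) 0"
      "has_bochner_integral M (\<lambda>\<omega>. (cmod (Z \<omega> $ p $ t))\<^sup>2) v" for p t
    using circ_gaussian_moments[of "\<lambda>\<omega>. Z \<omega> $ p $ t" v] Z pos
    by (auto simp: indep_circ_gaussian_entries_def)
  have GG: "expectation (\<lambda>\<omega>. G \<omega> $ l $ k * cnj (G \<omega> $ l' $ k')) = 0" if "(l, k) \<noteq> (l', k')" for l k l' k'
    using indep_vars_uncorrelated[OF Gvars that] Gmom by (auto simp: has_bochner_integral_iff)
  have ZZ: "expectation (\<lambda>\<omega>. Z \<omega> $ p $ t * cnj (Z \<omega> $ p' $ t')) = 0" if "(p, t) \<noteq> (p', t')" for p t p' t'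
    using indep_vars_uncorrelated[OF Zvars that] Zmom by (auto simp: has_bochner_integral_iff)
  \<comment> \<open>Entry projections and conjugation are continuous, hence Borel. The conjugate is
    absorbed into the map applied to \<open>Z\<close>, so the product rule for expectations applies
    directly.\<close>
  have "indep_var borel (\<lambda>\<omega>. G \<omega> $ l $ k) borel (\<lambda>\<omega>. cnj (Z \<omega> $ p $ t))" for l k p t
    by (rule indep_random_variables_compose[OF GZ])
      (intro borel_measurable_continuous_onI continuous_intros)+
  then have GZ: "expectation (\<lambda>\<omega>. G \<omega> $ l $ k * cnj (Z \<omega> $ p $ t)) = 0" for l k p t
    using indep_var_lebesgue_integral[of "\<lambda>\<omega>. G \<omega> $ l $ k" "\<lambda>\<omega>. cnj (Z \<omega> $ p $ t)"] Gmom Zmom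
    by (simp add: has_bochner_integral_iff comp_def)
  have ZG: "expectation (\<lambda>\<omega>. Z \<omega> $ p $ t * cnj (G \<omega> $ l $ k)) = 0" for l k p t
  proof -
    have "expectation (\<lambda>\<omega>. Z \<omega> $ p $ t * cnj (G \<omega> $ l $ k))
        = expectation (\<lambda>\<omega>. cnj (G \<omega> $ l $ k * cnj (Z \<omega> $ p $ t)))"
      by (simp add: mult.commute)
    then show ?thesis
      by (simp only: Bochner_Integration.integral_cnj GZ complex_cnj_zero)
  qed
  \<comment> \<open>For each column \<open>k\<close>, the entries of that column of \<open>G\<close>
    and all entries of \<open>Z\<close> form one family over the sum type
    \<open>'n + 'm \<times> 't\<close>, with coefficients \<open>c\<close> and variances
    \<open>w\<close>.\<close>
  define X where "X = (\<lambda>k. case_sum (\<lambda>l \<omega>. G \<omega> $ l $ k) (\<lambda>(p, t) \<omega>. Z \<omega> $ p $ t))"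
  define c where "c = (\<lambda>l k. case_sum (\<lambda>l'. P $ l $ l') (\<lambda>(p, t). Q $ l $ p * R $ t $ k))"
  define w where "w = (\<lambda>k. case_sum (\<lambda>_ :: 'n. \<gamma> k) (\<lambda>_ :: 'm \<times> 't. v))"
  have entry: "(P ** G \<omega> + Q ** Z \<omega> ** R) $ l $ k = (\<Sum>i\<in>UNIV. c l k i * X k i \<omega>)" for \<omega> l k
  proof -
    have "(\<Sum>i\<in>UNIV. c l k i * X k i \<omega>) = (\<Sum>l'\<in>UNIV. P $ l $ l' * G \<omega> $ l' $ k)
        + (\<Sum>p\<in>UNIV. \<Sum>t\<in>UNIV. Q $ l $ p * R $ t $ k * Z \<omega> $ p $ t)"
      by (simp add: c_def X_def sum.Plus sum.cartesian_product split_def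
          flip: UNIV_Plus_UNIV UNIV_Times_UNIV)
    also have "\<dots> = (P ** G \<omega> + Q ** Z \<omega> ** R) $ l $ k"
      by (subst sum.swap) (simp add: matrix_matrix_mult_def sum_distrib_left sum_distrib_right mult_ac)
    finally show ?thesis ..
  qed
  have "has_bochner_integral M (\<lambda>\<omega>. \<Sum>l\<in>UNIV. \<Sum>k\<in>UNIV. (cmod (\<Sum>i\<in>UNIV. c l k i * X k i \<omega>))\<^sup>2)
    (\<Sum>l\<in>UNIV. \<Sum>k\<in>UNIV. \<Sum>i\<in>UNIV. (cmod (c l k i))\<^sup>2 * w k i)"
  proof (intro has_bochner_integral_sum orthogonal_linear_combination)
    fix k and i j :: "'n + 'm \<times> 't"
    show "has_bochner_integral M (\<lambda>\<omega>. (cmod (X k i \<omega>))\<^sup>2) (w k i)"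
      by (cases i) (auto simp: X_def w_def Gmom Zmom)
    show "X k i \<in> borel_measurable M"
      using Gmom(1) Zmom(1)
      by (cases i) (auto simp: X_def intro: borel_measurable_has_bochner_integral)
    show "expectation (\<lambda>\<omega>. X k i \<omega> * cnj (X k j \<omega>)) = 0" if "i \<noteq> j"
      using that by (cases i; cases j) (auto simp: X_def GZ ZG intro!: GG ZZ)
  qed simp
  moreover have "(\<Sum>l\<in>UNIV. \<Sum>k\<in>UNIV. \<Sum>i\<in>UNIV. (cmod (c l k i))\<^sup>2 * w k i)
      = (norm P)\<^sup>2 * (\<Sum>k\<in>UNIV. \<gamma> k) + (norm Q)\<^sup>2 * (norm R)\<^sup>2 * v"
  proof -
    \<comment> \<open>The coefficient of a noise entry is a product of an entry of \<open>Q\<close>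
      and one of \<open>R\<close>, so the double sum factorizes; this produces the product of the
      two Frobenius norms.\<close>
    have "(\<Sum>i\<in>UNIV. (cmod (c l k i))\<^sup>2 * w k i) = (\<Sum>l'\<in>UNIV. (cmod (P $ l $ l'))\<^sup>2) * \<gamma> k
        + (\<Sum>p\<in>UNIV. (cmod (Q $ l $ p))\<^sup>2) * (\<Sum>t\<in>UNIV. (cmod (R $ t $ k))\<^sup>2) * v" for l k
      unfolding sum_product
      by (simp add: c_def w_def sum.Plus sum.cartesian_product split_def
          sum_distrib_right norm_mult power_mult_distrib flip: UNIV_Plus_UNIV UNIV_Times_UNIV)
    then have "(\<Sum>l\<in>UNIV. \<Sum>k\<in>UNIV. \<Sum>i\<in>UNIV. (cmod (c l k i))\<^sup>2 * w k i)
      = (norm P)\<^sup>2 * (\<Sum>k\<in>UNIV. \<gamma> k)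
        + (norm Q)\<^sup>2 * (\<Sum>k\<in>UNIV. \<Sum>t\<in>UNIV. (cmod (R $ t $ k))\<^sup>2) * v"
      by (simp add: sum.distrib norm_matrix_squared flip: sum_distrib_left sum_distrib_right)
    also have "(\<Sum>k\<in>UNIV. \<Sum>t\<in>UNIV. (cmod (R $ t $ k))\<^sup>2) = (norm R)\<^sup>2"
      unfolding norm_matrix_squared by (rule sum.swap)
    finally show ?thesis .
  qed
  ultimately show ?thesis
    by (simp only: entry norm_matrix_squared [of "_ + _"])
qed

end

section \<open>The estimator and its mean-squared error\<close>

theorem theorem1:
  fixes M :: "'w measure"
    and G :: "'w \<Rightarrow> complex ^ 'k::finite ^ 'n::finite"
    and Z :: "'w \<Rightarrow> complex ^ 't::finite ^ ('b::finite \<times> 'r::finite)"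
    and S :: "complex ^ 't ^ 'k"
    and \<gamma> :: "'k \<Rightarrow> real"
    and P\<^sub>t \<sigma> \<Gamma> :: real
    and conn :: "'r \<Rightarrow> 'n \<Rightarrow> bool"
    and \<rho> :: "'b \<Rightarrow> 'n \<Rightarrow> real"
    and \<phi> :: "'b \<Rightarrow> 'r \<Rightarrow> 'n \<Rightarrow> real"
  assumes "prob_space M"
    and "\<And>k. \<gamma> k > 0"
    and "P\<^sub>t > 0" and "\<sigma> > 0" and "\<Gamma> = P\<^sub>t / \<sigma>\<^sup>2"
    and "indep_circ_gaussian_entries M G (\<lambda>l k. \<gamma> k)"
    and "indep_circ_gaussian_entries M Z (\<lambda>p t. 1 / \<Gamma>)"
    and "indep_random_variables M G Z"
    and "S ** hermitian_transpose S = real CARD('t) *\<^sub>R mat 1"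
    and "reception_config \<rho> \<phi>"
  shows "\<exists>Ghat :: complex ^ 't ^ ('b \<times> 'r) \<Rightarrow> complex ^ 'k ^ 'n.
    Ghat \<in> borel_measurable borel \<and>
    integrable M (\<lambda>\<omega>. (norm (G \<omega> - Ghat (y_RC (A_RC conn \<rho> \<phi>) S (G \<omega>) (Z \<omega>))))\<^sup>2) \<and>
    complex_of_real
      (mean_squared_error M G (\<lambda>\<omega>. Ghat (y_RC (A_RC conn \<rho> \<phi>) S (G \<omega>) (Z \<omega>))))
      = channel_mse \<gamma> CARD('t) \<Gamma> (A_RC conn \<rho> \<phi>)"
proof -
  interpret prob_space M
    by fact
  define A :: "complex ^ 'n ^ ('b \<times> 'r)" where "A = A_RC conn \<rho> \<phi>"
  define g where "g = (\<Sum>k\<in>UNIV. \<gamma> k)"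
  define T where "T = real CARD('t)"
  define K where "K = real CARD('k)"
  define c where "c = T * (\<Gamma> / K)"
  define H where "H = hermitian_transpose A ** A"
  define B where "B = (1 / g) *\<^sub>R mat 1 + c *\<^sub>R H"
  define C where "C = matrix_inv B"
  define F where "F = C ** hermitian_transpose A"
  have pos: "g > 0" "T > 0" "K > 0" "\<Gamma> > 0"
    using assms by (auto simp: g_def T_def K_def intro!: sum_pos)
  then have "c > 0"
    by (simp add: c_def)
  have SS: "S ** hermitian_transpose S = T *\<^sub>R mat 1"
    using assms by (simp add: T_def)

  have "invertible B"
    unfolding B_def H_def using pos \<open>c > 0\<close> by (intro regularized_gram_invertible) simp_all
  then obtain C' where "B ** C' = mat 1"
    by (auto simp: invertible_def)
  then have BC: "B ** C = mat 1"
    using matrix_inv_unique C_def by metis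
  then have CB: "C ** B = mat 1"
    using matrix_left_right_inverse by blast
  have "hermitian_transpose B = B"
    by (simp add: B_def H_def hermitian_transpose_add hermitian_transpose_scaleR
        hermitian_transpose_mult hermitian_transpose_mat_1)
  \<comment> \<open>Transposing \<open>C ** B = mat 1\<close> makes the conjugate transpose of
    \<open>C\<close> another right inverse of the Hermitian \<open>B\<close>; by uniqueness
    \<open>C\<close> is Hermitian.\<close>
  then have "B ** hermitian_transpose C = mat 1"
    using arg_cong[OF CB, of hermitian_transpose]
    by (simp add: hermitian_transpose_mult hermitian_transpose_mat_1)
  then have herm_C: "hermitian_transpose C = C"
    using matrix_inv_unique C_def by metis
  \<comment> \<open>This expansion of \<open>C ** B = mat 1\<close> is used twice: to collapse the
    trace below and to rewrite the bias of the estimator as \<open>C\<close> times the channel over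
    \<open>g\<close>.\<close>
  have CH: "(1 / g) *\<^sub>R C + c *\<^sub>R (C ** H) = mat 1"
    using CB by (simp add: B_def matrix_add_ldistrib matrix_scalar_ac flip: scalar_matrix_assoc)

  \<comment> \<open>The total pilot energy is the trace of S S^H = T I.\<close>
  have "K = trace (mat 1 :: complex ^ 'k ^ 'k)"
    by (simp add: trace_def mat_def K_def)
  then have "complex_of_real ((norm S)\<^sup>2) = complex_of_real (T * K)"
    unfolding trace_mult_hermitian_transpose [symmetric]
    by (simp add: SS trace_scaleR scaleR_conv_of_real [where 'a = complex])
  then have norm_S: "(norm S)\<^sup>2 = T * K"
    by (simp only: of_real_eq_iff)

  \<comment> \<open>Since \<open>C\<close> is Hermitian, its squared norm is tr(C C), and F F^H = C
    H C. A common right factor \<open>C\<close> splits off and \<open>CH\<close> reduces the rest to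
    the identity.\<close>
  have "complex_of_real ((norm C)\<^sup>2 / g + c * (norm F)\<^sup>2)
      = (1 / g) *\<^sub>R trace (C ** C) + c *\<^sub>R trace (F ** hermitian_transpose F)"
    by (simp add: trace_mult_hermitian_transpose scaleR_conv_of_real [where 'a = complex]
        trace_mult_hermitian_transpose[of C, unfolded herm_C])
  also have "\<dots> = trace (((1 / g) *\<^sub>R C + c *\<^sub>R (C ** H)) ** C)"
    by (simp add: F_def H_def hermitian_transpose_mult herm_C trace_scaleR trace_add
        matrix_add_rdistrib matrix_mul_assoc flip: scalar_matrix_assoc)
  also have "\<dots> = trace C"
    by (simp add: CH)
  also have "\<dots> = channel_mse \<gamma> CARD('t) \<Gamma> A"
    using pos by (simp add: channel_mse_def C_def B_def H_def R_G_def c_def T_def K_def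
        matrix_inv_scaleR_mat_1 flip: g_def)
  finally have mse: "channel_mse \<gamma> CARD('t) \<Gamma> A = complex_of_real ((norm C)\<^sup>2 / g + c * (norm F)\<^sup>2)"
    by simp

  define Ghat where "Ghat = (\<lambda>Y. (c / T) *\<^sub>R (F ** Y ** hermitian_transpose S))"
  have "Ghat \<in> borel_measurable borel"
    unfolding Ghat_def matrix_matrix_mult_def
    by (intro borel_measurable_continuous_onI continuous_intros)
  \<comment> \<open>The error takes the shape P X + Q Y R required by
    \<open>mean_squared_norm_linear_combination\<close>: \<open>P\<close> carries the bias and
    \<open>Q\<close>, \<open>R\<close> the filtered noise.\<close>
  have error: "X - Ghat (y_RC A S X Y)
      = ((1 / g) *\<^sub>R C) ** X + ((- c / T) *\<^sub>R F) ** Y ** hermitian_transpose S" for X Y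
  proof -
    have "F ** (A ** X ** S) ** hermitian_transpose S = C ** H ** X ** (S ** hermitian_transpose S)"
      by (simp add: F_def H_def matrix_mul_assoc)
    also have "\<dots> = T *\<^sub>R (C ** H ** X)"
      by (simp add: SS matrix_scalar_ac flip: scalar_matrix_assoc)
    finally have "Ghat (y_RC A S X Y)
        = c *\<^sub>R (C ** H ** X) + (c / T) *\<^sub>R (F ** Y ** hermitian_transpose S)"
      using pos by (simp add: Ghat_def y_RC_def matrix_add_ldistrib matrix_add_rdistrib scaleR_add_right)
    moreover have "(1 / g) *\<^sub>R (C ** X) + c *\<^sub>R (C ** H ** X) = X"
      using arg_cong[OF CH, of "\<lambda>D. D ** X"]
      by (simp add: matrix_add_rdistrib flip: scalar_matrix_assoc)
    then have "X - c *\<^sub>R (C ** H ** X) = ((1 / g) *\<^sub>R C) ** X"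
      by (simp add: diff_eq_eq flip: scalar_matrix_assoc)
    moreover have "((- c / T) *\<^sub>R F) ** Y ** hermitian_transpose S
        = - ((c / T) *\<^sub>R (F ** Y ** hermitian_transpose S))"
      by (simp only: scalar_matrix_assoc [symmetric]) simp
    ultimately show ?thesis
      by (simp add: algebra_simps)
  qed
  have "has_bochner_integral M (\<lambda>\<omega>. (norm (G \<omega> - Ghat (y_RC A S (G \<omega>) (Z \<omega>))))\<^sup>2)
    ((norm ((1 / g) *\<^sub>R C))\<^sup>2 * g
      + (norm ((- c / T) *\<^sub>R F))\<^sup>2 * (norm (hermitian_transpose S))\<^sup>2 * (1 / \<Gamma>))"
    unfolding error g_def using assms pos by (intro mean_squared_norm_linear_combination) auto
  \<comment> \<open>The noise weight is (c / T)^2 (T K) / \<Gamma> = c, because c = T \<Gamma> / K: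
    the pilot energy \<open>T * K\<close> is exactly what the division by \<open>K\<close> in
    \<open>c\<close> compensates.\<close>
  also have "(norm ((1 / g) *\<^sub>R C))\<^sup>2 * g
      + (norm ((- c / T) *\<^sub>R F))\<^sup>2 * (norm (hermitian_transpose S))\<^sup>2 * (1 / \<Gamma>)
      = (norm C)\<^sup>2 / g + c * (norm F)\<^sup>2"
    using pos by (simp add: norm_hermitian_transpose norm_S power_mult_distrib power_divide)
      (simp add: c_def power2_eq_square field_simps)
  finally show ?thesis
    using \<open>Ghat \<in> borel_measurable borel\<close> mse
    by (intro exI[of _ Ghat]) (simp add: mean_squared_error_def has_bochner_integral_iff flip: A_def)
qed

end
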